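(* Let $M,N,K$ be integers with $1\le K\le N-1$ and $N\le M$, and let $\Lambda^{M,N}_K$ be the largest possible eigenvalue of a trace-one $K$-particle reduced density matrix of an $N$-particle fermionic pure state over an $M$-dimensional one-particle Hilbert space. Then the following lower bounds hold, where $m,n,k$ are non-negative integers. (1) If $M=2m$ or $M=2m+1$, $N=2n$ and $K=2k$, then $$\Lambda^{M,N}_K\ \ge\ \frac{\binom{n}{k}}{\binom{N}{K}}\,\frac{\binom{m-n+k}{k}}{\binom{m}{k}}.$$ (2) If $M=2m$ or $M=2m+1$, $N=2n$ and $K=2k+1$, then $$\Lambda^{M,N}_K\ \ge\ \frac{\binom{n-1}{k}}{\binom{N}{K}}\,\frac{\binom{m-n+k}{k}}{\binom{m-1}{k}}.$$ (3) If $M=2m$, $N=2n+1$ and $K=2k$, then $$\Lambda^{M,N}_K\ \ge\ \frac{\binom{n}{k}}{\binom{N}{K}}\,\frac{\binom{m-1-n+k}{k}}{\binom{m-1}{k}}.$$ (4) If $M=2m+1$, $N=2n+1$ and $K=2k$, then $$\Lambda^{M,N}_K\ \ge\ \frac{\binom{n}{k}}{\binom{N}{K}}\,\frac{\binom{m-n+k}{k}}{\binom{m}{k}}.$$ Since $\Lambda^{M,N}_K=\Lambda^{M,N}_{N-K}$, the bounds (3) and (4), applied with $N-K$ in place of $K$, also give lower bounds for $\Lambda^{M,N}_K$ when $N$ and $K$ are both odd.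
   Context: Let $\mathcal{H}=\mathbb{C}^M$ and let $\wedge^N\mathcal{H}\subset\mathcal{H}^{\otimes N}$ be the antisymmetric subspace. For a unit vector $\Psi\in\wedge^N\mathcal{H}$, the $K$-particle reduced density matrix $\gamma_K^\Psi$ is the partial trace of $|\Psi\rangle\langle\Psi|$ over the last $N-K$ tensor factors, so $\mathrm{Tr}\,\gamma_K^\Psi=1$. Define $$\Lambda^{M,N}_K:=\sup_{\Psi\in\wedge^N\mathcal{H},\ \|\Psi\|=1}\lambda^{\max}(\gamma_K^\Psi),$$ where $\lambda^{\max}$ denotes the largest eigenvalue. *)

theory Defs
  imports
    Complex_Main
    "HOL-Combinatorics.Permutations"
    "Jordan_Normal_Form.Char_Poly"
    "Jordan_Normal_Form.Conjugate"
begin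

text \<open>The one-particle space is \<open>\<complex>\<^sup>M\<close> with standard basis \<open>e 0, ..., e (M - 1)\<close>, and
  its \<open>N\<close>-fold tensor power is identified with \<open>\<complex>\<close> to the power \<open>M ^ N\<close>, i.e. with
  \<^term>\<open>carrier_vec (M ^ N) :: complex vec set\<close>, by the usual Kronecker ordering: the coordinate
  of \<open>e x\<^sub>1 \<otimes> ... \<otimes> e x\<^sub>N\<close> is the number with base-\<open>M\<close> digits \<open>x\<^sub>1, ..., x\<^sub>N\<close>,
  the most significant digit coming first.\<close>

definition basis_tuples :: "nat \<Rightarrow> nat \<Rightarrow> nat list set" where
  "basis_tuples M N = {xs. set xs \<subseteq> {..<M} \<and> length xs = N}"

definition tensor_index :: "nat \<Rightarrow> nat list \<Rightarrow> nat" where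
  "tensor_index M xs = foldl (\<lambda>i x. i * M + x) 0 xs"

lemma tensor_index_Nil [simp]: "tensor_index M [] = 0"
  by (simp add: tensor_index_def)

lemma tensor_index_snoc [simp]: "tensor_index M (xs @ [x]) = tensor_index M xs * M + x"
  by (simp add: tensor_index_def)

text \<open>Splitting off the last factors is quotient and remainder by a power of \<open>M\<close>.\<close>

lemma tensor_index_append:
  "tensor_index M (xs @ ys) = tensor_index M xs * M ^ length ys + tensor_index M ys"
proof (induction ys rule: rev_induct)
  case Nil
  then show ?case by simp
next
  case (snoc y ys)
  have "tensor_index M (xs @ ys @ [y]) = tensor_index M (xs @ ys) * M + y"
    using tensor_index_snoc[of M "xs @ ys" y] by simp
  then show ?case using snoc by (simp add: algebra_simps)
qed

lemma tensor_index_less: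
  "set xs \<subseteq> {..<M} \<Longrightarrow> tensor_index M xs < M ^ length xs"
proof (induction xs rule: rev_induct)
  case Nil
  then show ?case by simp
next
  case (snoc x xs)
  then have "tensor_index M xs + 1 \<le> M ^ length xs" and "x < M" by auto
  then have "(tensor_index M xs + 1) * M \<le> M ^ length xs * M" and "x < M"
    using mult_le_mono1 by blast+
  then show ?case by (simp add: algebra_simps)
qed

lemma inj_on_tensor_index: "inj_on (tensor_index M) (basis_tuples M N)"
proof (induction N)
  case 0
  then show ?case by (auto simp: basis_tuples_def inj_on_def)
next
  case (Suc N)
  show ?case
  proof (rule inj_onI)
    fix xs ys
    assume "xs \<in> basis_tuples M (Suc N)" and "ys \<in> basis_tuples M (Suc N)"
      and eq: "tensor_index M xs = tensor_index M ys"
    then obtain xs' x ys' y where xs: "xs = xs' @ [x]" and ys: "ys = ys' @ [y]"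
      and m: "xs' \<in> basis_tuples M N" "ys' \<in> basis_tuples M N" "x < M" "y < M"
      by (cases xs rule: rev_cases; cases ys rule: rev_cases) (auto simp: basis_tuples_def)
    have e: "tensor_index M xs' * M + x = tensor_index M ys' * M + y"
      using eq xs ys by simp
    then have "(tensor_index M xs' * M + x) div M = (tensor_index M ys' * M + y) div M"
      by simp
    with m have t: "tensor_index M xs' = tensor_index M ys'" by simp
    with Suc m have "xs' = ys'" by (auto dest: inj_onD)
    with t e xs ys show "xs = ys" by simp
  qed
qed

lemma bij_betw_tensor_index: "bij_betw (tensor_index M) (basis_tuples M N) {..<M ^ N}"
proof -
  have "tensor_index M ` basis_tuples M N \<subseteq> {..<M ^ N}"
    using tensor_index_less by (fastforce simp: basis_tuples_def)
  moreover have "card (tensor_index M ` basis_tuples M N) = M ^ N"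
    using card_image[OF inj_on_tensor_index, of M N] card_lists_length_eq[of "{..<M}" N]
    by (simp add: basis_tuples_def)
  ultimately show ?thesis
    using inj_on_tensor_index by (simp add: bij_betw_def card_subset_eq)
qed

definition antisymmetric_space :: "nat \<Rightarrow> nat \<Rightarrow> complex vec set" where
  "antisymmetric_space M N =
     {\<Psi> \<in> carrier_vec (M ^ N). \<forall>\<sigma>. \<sigma> permutes {..<N} \<longrightarrow>
        (\<forall>xs \<in> basis_tuples M N.
           \<Psi> $ tensor_index M (permute_list \<sigma> xs) = of_int (sign \<sigma>) * \<Psi> $ tensor_index M xs)}"

definition projector :: "complex vec \<Rightarrow> complex mat" where
  "projector \<Psi> = mat (dim_vec \<Psi>) (dim_vec \<Psi>) (\<lambda>(i, j). \<Psi> $ i * cnj (\<Psi> $ j))"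

text \<open>Partial trace over the second factor of \<open>\<complex>\<^sup>a \<otimes> \<complex>\<^sup>b\<close>.\<close>

definition partial_trace :: "nat \<Rightarrow> nat \<Rightarrow> complex mat \<Rightarrow> complex mat" where
  "partial_trace a b A = mat a a (\<lambda>(i, j). \<Sum>l<b. A $$ (i * b + l, j * b + l))"

definition reduced_density_matrix :: "nat \<Rightarrow> nat \<Rightarrow> nat \<Rightarrow> complex vec \<Rightarrow> complex mat" where
  "reduced_density_matrix M N K \<Psi> = partial_trace (M ^ K) (M ^ (N - K)) (projector \<Psi>)"

text \<open>Meant for Hermitian matrices of positive dimension, whose eigenvalues are all real.\<close>

definition lambda_max :: "complex mat \<Rightarrow> real" where
  "lambda_max A = Max {x. eigenvalue A (complex_of_real x)}"

definition Lambda :: "nat \<Rightarrow> nat \<Rightarrow> nat \<Rightarrow> real" where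
  "Lambda M N K =
     (SUP \<Psi> \<in> {\<Psi> \<in> antisymmetric_space M N. \<Psi> \<bullet>c \<Psi> = 1}.
        lambda_max (reduced_density_matrix M N K \<Psi>))"

end

theory Submission
  imports Defs "HOL-Analysis.L2_Norm" "Jordan_Normal_Form.Spectral_Radius"
    "HOL-Combinatorics.Multiset_Permutations"
begin

text \<open>The reduced density matrix of \<open>\<Psi>\<close> is \<open>A A*\<close> for the coefficient matrix \<open>A\<close> of \<open>\<Psi>\<close> with respect
  to the splitting into the first \<open>K\<close> and the last \<open>N - K\<close> factors. Antisymmetry makes the matrix
  for the complementary splitting \<open>\<plusminus> A\<^sup>T\<close>, and \<open>A A*\<close> and \<open>A* A\<close> have the same largest eigenvalue.

  For the lower bounds, group the orbitals into pairs, up to a few fixed orbitals, and let \<open>\<Psi>\<close> be the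
  equal superposition of all Slater determinants consisting of the fixed orbitals and of \<open>q\<close> of the
  \<open>p\<close> pairs. Pairs commute, so no relative signs occur, and \<open>A*\<close> maps the analogous superposition of
  \<open>k\<close> pairs to a multiple of the one of \<open>q - k\<close> pairs, which \<open>A\<close> maps back. Counting the disjoint
  choices of pairs gives the eigenvalue.\<close>

section \<open>Gram matrices\<close>

text \<open>This is A A* for the a by b matrix A with entries \<open>f i l\<close>. Keeping A as a
  function makes its transpose a mere swap of arguments.\<close>

definition gram_mat :: "nat \<Rightarrow> nat \<Rightarrow> (nat \<Rightarrow> nat \<Rightarrow> complex) \<Rightarrow> complex mat" where
  "gram_mat a b f = mat a a (\<lambda>(i, j). \<Sum>l<b. f i l * cnj (f j l))"

lemma gram_mat_carrier [simp]: "gram_mat a b f \<in> carrier_mat a a"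
  by (simp add: gram_mat_def)

lemma gram_mat_mult_vec:
  assumes "v \<in> carrier_vec a" "i < a"
  shows "(gram_mat a b f *\<^sub>v v) $ i = (\<Sum>l<b. f i l * (\<Sum>j<a. cnj (f j l) * v $ j))"
proof -
  have "(gram_mat a b f *\<^sub>v v) $ i = (\<Sum>j<a. (\<Sum>l<b. f i l * cnj (f j l)) * v $ j)"
    using assms by (simp add: gram_mat_def scalar_prod_def lessThan_atLeast0)
  also have "\<dots> = (\<Sum>j<a. \<Sum>l<b. f i l * (cnj (f j l) * v $ j))"
    by (simp add: sum_distrib_right mult.assoc)
  also have "\<dots> = (\<Sum>l<b. \<Sum>j<a. f i l * (cnj (f j l) * v $ j))"
    by (rule sum.swap)
  finally show ?thesis by (simp add: sum_distrib_left)
qed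

text \<open>The sums are bracketed as A (A* v), so that later proofs can evaluate the contraction A*
  v first and apply A afterwards.\<close>

lemma eigenvalue_gram_mat_iff:
  "eigenvalue (gram_mat a b f) z \<longleftrightarrow>
     (\<exists>v. (\<exists>i<a. v i \<noteq> 0) \<and>
       (\<forall>i<a. (\<Sum>l<b. f i l * (\<Sum>j<a. cnj (f j l) * v j)) = z * v i))"
    (is "?L \<longleftrightarrow> (\<exists>v. ?R v)")
proof
  assume ?L
  then obtain v where v: "v \<in> carrier_vec a" "v \<noteq> 0\<^sub>v a" "gram_mat a b f *\<^sub>v v = z \<cdot>\<^sub>v v"
    by (auto simp: eigenvalue_def eigenvector_def gram_mat_def)
  then have "?R (\<lambda>i. v $ i)"
    using gram_mat_mult_vec[of v a _ b f] by (auto simp: vec_eq_iff)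
  then show "\<exists>v. ?R v" by (intro exI[of _ "\<lambda>i. v $ i"])
next
  assume "\<exists>v. ?R v"
  then obtain v where v: "?R v" ..
  have "eigenvector (gram_mat a b f) (vec a v) z"
    unfolding eigenvector_def
  proof (intro conjI)
    show "gram_mat a b f *\<^sub>v vec a v = z \<cdot>\<^sub>v vec a v"
    proof (rule eq_vecI)
      fix i assume "i < dim_vec (z \<cdot>\<^sub>v vec a v)"
      then show "(gram_mat a b f *\<^sub>v vec a v) $ i = (z \<cdot>\<^sub>v vec a v) $ i"
        using v by (simp add: gram_mat_mult_vec del: index_mult_mat_vec)
    qed (simp add: gram_mat_def)
  qed (use v in \<open>auto simp: gram_mat_def vec_eq_iff\<close>)
  then show ?L by (auto simp: eigenvalue_def)
qed

lemma norm_sum_mult_cnj_squared_le: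
  "(cmod (\<Sum>j\<in>A. cnj (f j) * g j))\<^sup>2 \<le> (\<Sum>j\<in>A. (cmod (f j))\<^sup>2) * (\<Sum>j\<in>A. (cmod (g j))\<^sup>2)"
proof -
  have "cmod (\<Sum>j\<in>A. cnj (f j) * g j) \<le> (\<Sum>j\<in>A. \<bar>cmod (f j)\<bar> * \<bar>cmod (g j)\<bar>)"
    by (rule order_trans[OF norm_sum]) (simp add: norm_mult)
  also have "\<dots> \<le> L2_set (\<lambda>j. cmod (f j)) A * L2_set (\<lambda>j. cmod (g j)) A"
    by (rule L2_set_mult_ineq)
  finally have "(cmod (\<Sum>j\<in>A. cnj (f j) * g j))\<^sup>2
      \<le> (L2_set (\<lambda>j. cmod (f j)) A * L2_set (\<lambda>j. cmod (g j)) A)\<^sup>2"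
    by (rule power_mono) simp
  then show ?thesis
    by (simp add: L2_set_def power_mult_distrib sum_nonneg)
qed

text \<open>Pairing the eigenvalue equation with v gives z = |A* v|^2 / |v|^2, a nonnegative real,
  and Cauchy-Schwarz bounds this quotient by the squared Frobenius norm of A.\<close>

lemma eigenvalue_gram_mat_bounds:
  assumes "eigenvalue (gram_mat a b f) z"
  obtains x where "z = complex_of_real x" "0 \<le> x" "x \<le> (\<Sum>i<a. \<Sum>l<b. (cmod (f i l))\<^sup>2)"
proof -
  from assms obtain v where nz: "\<exists>i<a. v i \<noteq> 0"
    and eq: "\<And>i. i < a \<Longrightarrow> (\<Sum>l<b. f i l * (\<Sum>j<a. cnj (f j l) * v j)) = z * v i"
    by (auto simp: eigenvalue_gram_mat_iff)
  define w where "w l = (\<Sum>j<a. cnj (f j l) * v j)" for l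
  define n where "n = (\<Sum>i<a. (cmod (v i))\<^sup>2)"
  define s where "s = (\<Sum>l<b. (cmod (w l))\<^sup>2)"
  have n: "n > 0"
    using nz unfolding n_def by (auto intro: sum_pos2)
  have "z * complex_of_real n = (\<Sum>i<a. (z * v i) * cnj (v i))"
    by (simp add: n_def complex_norm_square sum_distrib_left mult.assoc del: of_real_power)
  also have "\<dots> = (\<Sum>i<a. \<Sum>l<b. f i l * w l * cnj (v i))"
    by (intro sum.cong) (simp_all add: eq[symmetric] w_def sum_distrib_right)
  also have "\<dots> = (\<Sum>l<b. \<Sum>i<a. f i l * w l * cnj (v i))"
    by (rule sum.swap)
  also have "\<dots> = (\<Sum>l<b. w l * cnj (w l))"
    by (intro sum.cong) (simp_all add: w_def sum_distrib_left mult_ac)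
  also have "\<dots> = complex_of_real s"
    by (simp add: s_def complex_norm_square del: of_real_power)
  finally have "z * complex_of_real n = complex_of_real s" .
  then have z: "z = complex_of_real (s / n)"
    using n by (simp add: field_simps)
  have "s \<le> (\<Sum>l<b. (\<Sum>i<a. (cmod (f i l))\<^sup>2) * n)"
    unfolding s_def w_def n_def by (intro sum_mono norm_sum_mult_cnj_squared_le)
  also have "\<dots> = (\<Sum>l<b. \<Sum>i<a. (cmod (f i l))\<^sup>2) * n"
    by (rule sum_distrib_right[symmetric])
  also have "(\<Sum>l<b. \<Sum>i<a. (cmod (f i l))\<^sup>2) = (\<Sum>i<a. \<Sum>l<b. (cmod (f i l))\<^sup>2)"
    by (rule sum.swap)
  finally have "s / n \<le> (\<Sum>i<a. \<Sum>l<b. (cmod (f i l))\<^sup>2)"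
    using n by (simp add: field_simps)
  moreover have "0 \<le> s / n"
    using n by (simp add: s_def sum_nonneg)
  ultimately show ?thesis using z that by blast
qed

text \<open>\<open>lambda_max\<close> is a \<open>Max\<close> over real eigenvalues, meaningful only
  if that set is finite and nonempty. A complex matrix of positive size has an eigenvalue, and for A
  A* every eigenvalue is real.\<close>

lemma gram_mat_spectrum:
  assumes "a > 0"
  shows "finite {x. eigenvalue (gram_mat a b f) (complex_of_real x)}"
    and "{x. eigenvalue (gram_mat a b f) (complex_of_real x)} \<noteq> {}"
proof -
  have "finite (complex_of_real -` spectrum (gram_mat a b f))"
    by (intro finite_vimageI card_finite_spectrum(1)[where n = a]) (auto simp: inj_on_def)
  then show "finite {x. eigenvalue (gram_mat a b f) (complex_of_real x)}"
    by (simp add: spectrum_def vimage_def)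
  obtain z where "eigenvalue (gram_mat a b f) z"
    using spectrum_non_empty[OF gram_mat_carrier assms, of b f] by (auto simp: spectrum_def)
  then show "{x. eigenvalue (gram_mat a b f) (complex_of_real x)} \<noteq> {}"
    using eigenvalue_gram_mat_bounds[of a b f z] by blast
qed

lemma lambda_max_gram_mat_ge:
  assumes "a > 0" "eigenvalue (gram_mat a b f) (complex_of_real x)"
  shows "x \<le> lambda_max (gram_mat a b f)"
  using assms gram_mat_spectrum(1)[of a b f] by (simp add: lambda_max_def)

lemma eigenvalue_lambda_max_gram_mat:
  assumes "a > 0"
  shows "eigenvalue (gram_mat a b f) (complex_of_real (lambda_max (gram_mat a b f)))"
  using Max_in[OF gram_mat_spectrum[OF assms]] by (simp add: lambda_max_def)

lemma lambda_max_gram_mat_bounds: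
  assumes "a > 0"
  shows "0 \<le> lambda_max (gram_mat a b f)"
    and "lambda_max (gram_mat a b f) \<le> (\<Sum>i<a. \<Sum>l<b. (cmod (f i l))\<^sup>2)"
  by (rule eigenvalue_gram_mat_bounds[OF eigenvalue_lambda_max_gram_mat[OF assms]], simp)+

text \<open>The spectra of \<open>A A*\<close> and of \<open>A\<^sup>T (A\<^sup>T)*\<close>, the complex conjugate of \<open>A* A\<close>, agree
  away from zero.\<close>

lemma eigenvalue_gram_mat_transpose:
  assumes "eigenvalue (gram_mat a b f) (complex_of_real x)" "x \<noteq> 0"
  shows "eigenvalue (gram_mat b a (\<lambda>l i. f i l)) (complex_of_real x)"
proof -
  from assms(1) obtain v where nz: "\<exists>i<a. v i \<noteq> 0"
    and eq: "\<And>i. i < a \<Longrightarrow> (\<Sum>l<b. f i l * (\<Sum>j<a. cnj (f j l) * v j)) = of_real x * v i"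
    by (auto simp: eigenvalue_gram_mat_iff)
  \<comment> \<open>\<open>w\<close> is the complex conjugate of A* v. The conjugation is needed
    since the transposed Gram matrix is the conjugate of A* A.\<close>
  define w where "w l = (\<Sum>j<a. f j l * cnj (v j))" for l
  have w: "(\<Sum>l<b. cnj (f i l) * w l) = of_real x * cnj (v i)" if "i < a" for i
    using arg_cong[OF eq[OF that], of cnj] by (simp add: w_def)
  have "\<exists>l<b. w l \<noteq> 0"
  proof (rule ccontr)
    assume "\<not> (\<exists>l<b. w l \<noteq> 0)"
    then have "v i = 0" if "i < a" for i
      using w[OF that] assms(2) by simp
    with nz show False by blast
  qed
  moreover have "(\<Sum>i<a. f i l * (\<Sum>m<b. cnj (f i m) * w m)) = of_real x * w l" for l
  proof -
    have "(\<Sum>i<a. f i l * (\<Sum>m<b. cnj (f i m) * w m)) = (\<Sum>i<a. f i l * (of_real x * cnj (v i)))"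
      by (intro sum.cong) (simp_all add: w)
    then show ?thesis
      by (simp add: w_def[of l] sum_distrib_left mult_ac)
  qed
  ultimately show ?thesis
    by (auto simp: eigenvalue_gram_mat_iff)
qed

lemma lambda_max_gram_mat_transpose:
  assumes "a > 0" "b > 0"
  shows "lambda_max (gram_mat a b f) = lambda_max (gram_mat b a (\<lambda>l i. f i l))"
proof -
  have "lambda_max (gram_mat a b f) \<le> lambda_max (gram_mat b a (\<lambda>l i. f i l))"
    if "a > 0" "b > 0" for a b f
  \<comment> \<open>Eigenvalues transfer only away from zero; a vanishing maximum lies below the
    other one by nonnegativity instead.\<close>
  proof (cases "lambda_max (gram_mat a b f) = 0")
    case True
    then show ?thesis using that by (simp add: lambda_max_gram_mat_bounds(1))
  next
    case False
    have "eigenvalue (gram_mat b a (\<lambda>l i. f i l)) (complex_of_real (lambda_max (gram_mat a b f)))"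
      using eigenvalue_lambda_max_gram_mat[OF that(1)] False
      by (rule eigenvalue_gram_mat_transpose)
    then show ?thesis
      by (rule lambda_max_gram_mat_ge[OF that(2)])
  qed
  from this[of a b f] this[of b a "\<lambda>l i. f i l"] assms show ?thesis by simp
qed

section \<open>Reduced density matrices\<close>

text \<open>In \<open>i * M ^ (N - K) + l\<close> the quotient \<open>i\<close> encodes the first
  \<open>K\<close> factors and the remainder \<open>l\<close> the traced ones. Tracing out
  \<open>l\<close> multiplies the coefficient matrix by its adjoint.\<close>

lemma reduced_density_matrix_eq_gram_mat:
  assumes "\<Psi> \<in> carrier_vec (M ^ N)" "K \<le> N"
  shows "reduced_density_matrix M N K \<Psi> =
    gram_mat (M ^ K) (M ^ (N - K)) (\<lambda>i l. \<Psi> $ (i * M ^ (N - K) + l))"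
proof -
  have "i * M ^ (N - K) + l < M ^ N" if "i < M ^ K" "l < M ^ (N - K)" for i l
  proof -
    have "i * M ^ (N - K) + l < (i + 1) * M ^ (N - K)" using that by simp
    also have "\<dots> \<le> M ^ K * M ^ (N - K)" using that by (intro mult_le_mono1) simp
    also have "\<dots> = M ^ N" using assms(2) by (simp flip: power_add)
    finally show ?thesis .
  qed
  then show ?thesis
    using assms(1)
    by (auto simp: reduced_density_matrix_def partial_trace_def gram_mat_def projector_def
        intro!: eq_matI sum.cong)
qed

lemma sum_tensor_index:
  "(\<Sum>i<M ^ N. f i) = (\<Sum>xs\<in>basis_tuples M N. f (tensor_index M xs))"
  by (rule sum.reindex_bij_betw[OF bij_betw_tensor_index, symmetric])

lemma tensor_index_surj:
  assumes "i < M ^ N"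
  obtains xs where "xs \<in> basis_tuples M N" "i = tensor_index M xs"
  using bij_betw_tensor_index[of M N] assms by (auto simp: bij_betw_def)

text \<open>Concatenation is a bijection from pairs of block tuples to tuples of length
  \<open>N\<close>. It turns the squared Frobenius norm of the coefficient matrix into the squared
  norm of the state.\<close>

lemma sum_tensor_index_append:
  fixes M :: nat
  assumes "K \<le> N"
  shows "(\<Sum>i<M ^ K. \<Sum>l<M ^ (N - K). f (i * M ^ (N - K) + l)) = (\<Sum>i<M ^ N. f i)"
proof -
  have "(\<Sum>i<M ^ K. \<Sum>l<M ^ (N - K). f (i * M ^ (N - K) + l)) =
      (\<Sum>xs\<in>basis_tuples M K. \<Sum>ys\<in>basis_tuples M (N - K). f (tensor_index M (xs @ ys)))"
    by (auto simp: sum_tensor_index tensor_index_append basis_tuples_def intro!: sum.cong)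
  also have "\<dots> = (\<Sum>(xs, ys)\<in>basis_tuples M K \<times> basis_tuples M (N - K).
      f (tensor_index M (xs @ ys)))"
    by (rule sum.cartesian_product)
  also have "\<dots> = (\<Sum>zs\<in>basis_tuples M N. f (tensor_index M zs))"
    using assms
    by (intro sum.reindex_bij_witness[of _ "\<lambda>zs. (take K zs, drop K zs)" "\<lambda>(xs, ys). xs @ ys"])
      (auto simp: basis_tuples_def dest: in_set_takeD in_set_dropD)
  finally show ?thesis by (simp add: sum_tensor_index)
qed

lemma scalar_prod_conjugate_self:
  assumes "\<Psi> \<in> carrier_vec n"
  shows "\<Psi> \<bullet>c \<Psi> = complex_of_real (\<Sum>i<n. (cmod (\<Psi> $ i))\<^sup>2)"
  using assms
  by (simp add: scalar_prod_def complex_norm_square lessThan_atLeast0 del: of_real_power)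

text \<open>A real \<open>SUP\<close> can be compared with its members only once boundedness is
  known; the Frobenius bound gives 1 for every normalised state.\<close>

lemma bdd_above_lambda_max_reduced_density_matrix:
  assumes "M > 0" "K \<le> N"
  shows "bdd_above ((\<lambda>\<Psi>. lambda_max (reduced_density_matrix M N K \<Psi>)) `
    {\<Psi> \<in> antisymmetric_space M N. \<Psi> \<bullet>c \<Psi> = 1})"
proof (rule bdd_aboveI2)
  fix \<Psi> assume "\<Psi> \<in> {\<Psi> \<in> antisymmetric_space M N. \<Psi> \<bullet>c \<Psi> = 1}"
  then have \<Psi>: "\<Psi> \<in> carrier_vec (M ^ N)" "\<Psi> \<bullet>c \<Psi> = 1"
    by (auto simp: antisymmetric_space_def)
  have "lambda_max (reduced_density_matrix M N K \<Psi>) \<le>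
      (\<Sum>i<M ^ K. \<Sum>l<M ^ (N - K). (cmod (\<Psi> $ (i * M ^ (N - K) + l)))\<^sup>2)"
    using assms \<Psi> by (simp add: reduced_density_matrix_eq_gram_mat lambda_max_gram_mat_bounds)
  also have "\<dots> = (\<Sum>i<M ^ N. (cmod (\<Psi> $ i))\<^sup>2)"
    by (rule sum_tensor_index_append[OF assms(2)])
  also have "\<dots> = 1"
    using \<Psi>(2) unfolding scalar_prod_conjugate_self[OF \<Psi>(1)] of_real_eq_1_iff .
  finally show "lambda_max (reduced_density_matrix M N K \<Psi>) \<le> 1" .
qed

lemma Lambda_ge:
  assumes "M > 0" "K \<le> N" "\<Psi> \<in> antisymmetric_space M N" "\<Psi> \<bullet>c \<Psi> = 1"
    and "eigenvalue (reduced_density_matrix M N K \<Psi>) (complex_of_real x)"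
  shows "x \<le> Lambda M N K"
proof -
  have "x \<le> lambda_max (reduced_density_matrix M N K \<Psi>)"
    using assms by (auto simp: reduced_density_matrix_eq_gram_mat antisymmetric_space_def
        intro!: lambda_max_gram_mat_ge)
  also have "\<dots> \<le> Lambda M N K"
    unfolding Lambda_def using assms
    by (intro cSUP_upper bdd_above_lambda_max_reduced_density_matrix) auto
  finally show ?thesis .
qed

section \<open>Complementary particle numbers\<close>

lemma rotation_permutes: "(\<lambda>i. if i < N then (i + K) mod N else i) permutes {..<N::nat}"
proof (rule bij_imp_permutes)
  have "inj_on (\<lambda>i. if i < N then (i + K) mod N else i) {..<N}"
  proof (rule linorder_inj_onI)
    fix i j assume ij: "i < j" "i \<in> {..<N}" "j \<in> {..<N}"
    then have "\<not> N dvd (j + K) - (i + K)"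
      by (auto dest: dvd_imp_le)
    then have "(j + K) mod N \<noteq> (i + K) mod N"
      using ij mod_eq_dvd_iff_nat[of "i + K" "j + K" N] by simp
    then show "(if i < N then (i + K) mod N else i) \<noteq> (if j < N then (j + K) mod N else j)"
      using ij by simp
  qed auto
  then show "bij_betw (\<lambda>i. if i < N then (i + K) mod N else i) {..<N} {..<N}"
    unfolding bij_betw_def by (intro conjI endo_inj_surj) auto
qed auto

text \<open>The cyclic shift by \<open>K\<close> places exchanges the blocks. Only the unit modulus
  of its sign \<open>e\<close> matters afterwards, so the value is left open.\<close>

lemma antisymmetric_space_exchange_blocks:
  assumes "\<Psi> \<in> antisymmetric_space M N" "K \<le> N"
  obtains e :: complex where "e * cnj e = 1"
    and "\<And>i l. i < M ^ K \<Longrightarrow> l < M ^ (N - K) \<Longrightarrow>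
      \<Psi> $ (l * M ^ K + i) = e * \<Psi> $ (i * M ^ (N - K) + l)"
proof
  define \<sigma> where "\<sigma> = (\<lambda>i. if i < N then (i + K) mod N else i)"
  show "complex_of_int (sign \<sigma>) * cnj (complex_of_int (sign \<sigma>)) = 1"
    by (simp flip: of_int_mult)
  fix i l assume "i < M ^ K" "l < M ^ (N - K)"
  then obtain xs ys where xy: "xs \<in> basis_tuples M K" "i = tensor_index M xs"
      "ys \<in> basis_tuples M (N - K)" "l = tensor_index M ys"
    by (meson tensor_index_surj)
  then have len: "length xs = K" "length ys = N - K" and mem: "xs @ ys \<in> basis_tuples M N"
    using assms(2) by (auto simp: basis_tuples_def)
  have "permute_list \<sigma> (xs @ ys) = rotate K (xs @ ys)"
    using len assms(2) by (intro nth_equalityI)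
      (simp_all add: permute_list_def \<sigma>_def nth_rotate add.commute)
  also have "\<dots> = ys @ xs"
    using rotate_append[of xs ys] len by simp
  finally have "\<Psi> $ tensor_index M (ys @ xs) = of_int (sign \<sigma>) * \<Psi> $ tensor_index M (xs @ ys)"
    using assms(1) mem rotation_permutes[of N K]
    unfolding antisymmetric_space_def \<sigma>_def by fastforce
  then show "\<Psi> $ (l * M ^ K + i) = of_int (sign \<sigma>) * \<Psi> $ (i * M ^ (N - K) + l)"
    using xy len by (simp add: tensor_index_append)
qed

lemma lambda_max_reduced_density_matrix_complement:
  assumes "M > 0" "K \<le> N" "\<Psi> \<in> antisymmetric_space M N"
  shows "lambda_max (reduced_density_matrix M N K \<Psi>) =
    lambda_max (reduced_density_matrix M N (N - K) \<Psi>)"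
proof -
  obtain e :: complex where e: "e * cnj e = 1"
    and ex: "\<And>i l. i < M ^ K \<Longrightarrow> l < M ^ (N - K) \<Longrightarrow>
      \<Psi> $ (l * M ^ K + i) = e * \<Psi> $ (i * M ^ (N - K) + l)"
    using antisymmetric_space_exchange_blocks[OF assms(3,2)] by metis
  have \<Psi>: "\<Psi> \<in> carrier_vec (M ^ N)" using assms(3) by (simp add: antisymmetric_space_def)
  \<comment> \<open>The phase is common to all amplitudes, so it drops out of each product of an
    amplitude with a conjugated one.\<close>
  have cancel: "e * a * (cnj e * cnj b) = a * cnj b" for a b
    using e by (metis mult.left_commute mult.commute mult_1)
  have "lambda_max (reduced_density_matrix M N K \<Psi>) =
      lambda_max (gram_mat (M ^ (N - K)) (M ^ K) (\<lambda>l i. \<Psi> $ (i * M ^ (N - K) + l)))"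
    unfolding reduced_density_matrix_eq_gram_mat[OF \<Psi> assms(2)]
    by (rule lambda_max_gram_mat_transpose) (use assms(1) in simp_all)
  also have "gram_mat (M ^ (N - K)) (M ^ K) (\<lambda>l i. \<Psi> $ (i * M ^ (N - K) + l)) =
      gram_mat (M ^ (N - K)) (M ^ K) (\<lambda>l i. \<Psi> $ (l * M ^ K + i))"
    by (auto simp: gram_mat_def ex cancel intro!: eq_matI sum.cong)
  also have "\<dots> = reduced_density_matrix M N (N - K) \<Psi>"
    using reduced_density_matrix_eq_gram_mat[OF \<Psi>, of "N - K"] assms(2) by simp
  finally show ?thesis .
qed

lemma Lambda_complement:
  assumes "M > 0" "K \<le> N"
  shows "Lambda M N K = Lambda M N (N - K)"
  unfolding Lambda_def
proof (rule SUP_cong[OF refl])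
  fix \<Psi> assume "\<Psi> \<in> {\<Psi> \<in> antisymmetric_space M N. \<Psi> \<bullet>c \<Psi> = 1}"
  then have "\<Psi> \<in> antisymmetric_space M N" by blast
  with assms show "lambda_max (reduced_density_matrix M N K \<Psi>) =
      lambda_max (reduced_density_matrix M N (N - K) \<Psi>)"
    by (rule lambda_max_reduced_density_matrix_complement)
qed

section \<open>Slater determinants\<close>

text \<open>For distinct entries this is (-1) to the number of inversions, the sign of the sorting
  permutation; a repeated entry makes it 0, as in a determinant with two equal columns.\<close>

primrec order_sign :: "nat list \<Rightarrow> int" where
  "order_sign [] = 1"
| "order_sign (x # xs) = (\<Prod>y\<leftarrow>xs. sgn (int y - int x)) * order_sign xs"

text \<open>These are the factors of \<open>order_sign (xs @ ys)\<close> that compare the two blocks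
  with each other.\<close>

definition cross_sign :: "nat list \<Rightarrow> nat list \<Rightarrow> int" where
  "cross_sign xs ys = (\<Prod>x\<leftarrow>xs. \<Prod>y\<leftarrow>ys. sgn (int y - int x))"

lemma prod_list_map_mult:
  fixes f g :: "'a \<Rightarrow> 'b :: comm_monoid_mult"
  shows "(\<Prod>x\<leftarrow>xs. f x * g x) = (\<Prod>x\<leftarrow>xs. f x) * (\<Prod>x\<leftarrow>xs. g x)"
  by (induction xs) (simp_all add: mult_ac)

lemma cross_sign_Nil [simp]: "cross_sign [] ys = 1" "cross_sign xs [] = 1"
  by (simp_all add: cross_sign_def map_replicate_const)

lemma cross_sign_append [simp]:
  "cross_sign (xs @ xs') ys = cross_sign xs ys * cross_sign xs' ys"
  "cross_sign xs (ys @ ys') = cross_sign xs ys * cross_sign xs ys'"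
  by (simp_all add: cross_sign_def prod_list_map_mult mult_ac)

lemma cross_sign_Cons:
  "cross_sign (x # xs) ys = cross_sign [x] ys * cross_sign xs ys"
  "cross_sign xs (y # ys) = cross_sign xs [y] * cross_sign xs ys"
  using cross_sign_append(1)[of "[x]" xs ys] cross_sign_append(2)[of xs "[y]" ys] by simp_all

lemma cross_sign_singletons_swap: "cross_sign [x] [y] = - cross_sign [y] [x]"
  by (simp add: cross_sign_def sgn_if)

lemma cross_sign_singleton_swap: "cross_sign [x] ys = (- 1) ^ length ys * cross_sign ys [x]"
proof (induction ys)
  case (Cons y ys)
  then show ?case
    by (simp add: cross_sign_Cons(2)[of "[x]" y ys] cross_sign_Cons(1)[of y ys "[x]"]
        cross_sign_singletons_swap[of x y])
qed simp

text \<open>Each of the \<open>length xs * length ys\<close> comparisons between the blocks changes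
  its sign.\<close>

lemma cross_sign_swap:
  "cross_sign xs ys = (- 1) ^ (length xs * length ys) * cross_sign ys xs"
proof (induction xs)
  case (Cons x xs)
  then show ?case
    by (simp add: cross_sign_Cons(1)[of x xs ys] cross_sign_Cons(2)[of ys x xs]
        cross_sign_singleton_swap[of x ys] power_add)
qed simp

lemma order_sign_append:
  "order_sign (xs @ ys) = order_sign xs * cross_sign xs ys * order_sign ys"
  by (induction xs) (simp_all add: cross_sign_def prod_list_map_mult mult_ac)

lemma order_sign_append_swap:
  "order_sign (xs @ ys) = (- 1) ^ (length xs * length ys) * order_sign (ys @ xs)"
  by (simp add: order_sign_append cross_sign_swap[of xs ys])

text \<open>The direct comparison of \<open>x\<close> and \<open>y\<close> flips. Comparisons with
  \<open>bs\<close> change by (-1) to the power \<open>length bs\<close> once for \<open>x\<close>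
  and once for \<open>y\<close>, and these two factors cancel.\<close>

lemma order_sign_exchange:
  "order_sign (as @ [y] @ bs @ [x] @ cs) = - order_sign (as @ [x] @ bs @ [y] @ cs)"
  unfolding order_sign_append cross_sign_append
  by (simp add: cross_sign_singletons_swap[of y x] cross_sign_singleton_swap[of y bs]
      cross_sign_singleton_swap[of x bs] mult_ac)

lemma order_sign_squared: "(order_sign xs)\<^sup>2 = (if distinct xs then 1 else 0)"
proof (induction xs)
  case (Cons x xs)
  have "(\<Prod>y\<leftarrow>xs. sgn (int y - int x))\<^sup>2 = (if x \<in> set xs then 0 else 1)"
    by (induction xs) (auto simp: power_mult_distrib sgn_if)
  with Cons show ?case by (simp add: power_mult_distrib)
qed simp

lemma order_sign_eq_0_iff: "order_sign xs = 0 \<longleftrightarrow> \<not> distinct xs"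
  using order_sign_squared[of xs] by (auto split: if_splits)

lemma order_sign_not_distinct: "\<not> distinct xs \<Longrightarrow> order_sign xs = 0"
  by (simp add: order_sign_eq_0_iff)

lemma order_sign_permute_list_transpose:
  assumes "a < b" "b < length xs"
  shows "order_sign (permute_list (Transposition.transpose a b) xs) = - order_sign xs"
proof -
  obtain x y as bs cs where xs: "xs = as @ [x] @ bs @ [y] @ cs"
    and len: "length as = a" "length (as @ [x] @ bs) = b"
  proof -
    obtain ys y cs where b: "xs = ys @ y # cs" "length ys = b"
      using id_take_nth_drop[OF assms(2)] assms(2) by (metis length_take min.absorb4)
    then obtain as x bs where a: "ys = as @ x # bs" "length as = a"
      using id_take_nth_drop[of a ys] assms(1) by (metis length_take min.absorb4)
    show ?thesis
      using that[of as x bs y cs] a b by simp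
  qed
  have ab: "xs ! a = x" "xs ! b = y"
    using len by (auto simp: xs nth_append)
  have "permute_list (Transposition.transpose a b) xs = xs[a := xs ! b, b := xs ! a]"
    using assms
    by (intro nth_equalityI)
      (auto simp: permute_list_def nth_list_update Transposition.transpose_def)
  also have "\<dots> = xs[a := y, b := x]"
    unfolding ab ..
  also have "xs[a := y] = (as @ [y] @ bs) @ y # cs"
    using list_update_length[of as x "bs @ y # cs" y] unfolding xs len(1) by simp
  also have "\<dots>[b := x] = as @ [y] @ bs @ [x] @ cs"
  proof -
    have "length (as @ [y] @ bs) = b" using len by simp
    then show ?thesis using list_update_length[of "as @ [y] @ bs" y cs x] by simp
  qed
  finally have eq: "permute_list (Transposition.transpose a b) xs = as @ [y] @ bs @ [x] @ cs" .
  show ?thesis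
    unfolding eq unfolding xs by (rule order_sign_exchange)
qed

text \<open>Transpositions generate all permutations, and each of them negates both signs.\<close>

lemma order_sign_permute_list:
  assumes "\<sigma> permutes {..<length xs}"
  shows "order_sign (permute_list \<sigma> xs) = sign \<sigma> * order_sign xs"
proof -
  define n where "n = length xs"
  \<comment> \<open>The list is quantified because the induction hypothesis for \<open>p\<close> is
    used at the list already permuted by the transposition.\<close>
  have "\<forall>xs. length xs = n \<longrightarrow> order_sign (permute_list \<sigma> xs) = sign \<sigma> * order_sign xs"
    using assms[folded n_def] finite_lessThan[of n]
  proof (induction rule: permutes_induct)
    case id
    then show ?case by simp
  next
    case (swap a b p)
    show ?case
    proof (intro allI impI)
      fix xs :: "nat list" assume len: "length xs = n"
      have "order_sign (permute_list (Transposition.transpose a b) xs) = - order_sign xs"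
      proof (cases "a < b")
        case True
        then show ?thesis
          using swap(2) len by (intro order_sign_permute_list_transpose) auto
      next
        case False
        then have "order_sign (permute_list (Transposition.transpose b a) xs) = - order_sign xs"
          using swap(1,3) len by (intro order_sign_permute_list_transpose) auto
        then show ?thesis by (subst transpose_commute)
      qed
      moreover have "permutation p"
        unfolding permutation_permutes using swap(4) by blast
      then have "sign (Transposition.transpose a b \<circ> p) = - sign p"
        using swap(3) by (simp add: sign_compose permutation_swap_id sign_swap_id)
      ultimately show "order_sign (permute_list (Transposition.transpose a b \<circ> p) xs) =
          sign (Transposition.transpose a b \<circ> p) * order_sign xs"
        using swap(4,5) len by (simp add: permute_list_compose)
    qed
  qed
  then show ?thesis by (simp add: n_def)
qed

section \<open>Superpositions of Slater determinants\<close>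

definition subsets_of_card :: "nat \<Rightarrow> nat \<Rightarrow> nat set set" where
  "subsets_of_card M N = {I. I \<subseteq> {..<M} \<and> card I = N}"

lemma finite_subsets_of_card [simp]: "finite (subsets_of_card M N)"
  by (simp add: subsets_of_card_def)

lemma finite_basis_tuples [simp]: "finite (basis_tuples M N)"
  unfolding basis_tuples_def by (intro finite_lists_length_eq) simp

text \<open>The square removes tuples with repetitions, and each set is listed by
  \<open>fact N\<close> of the others. Sums over the tensor basis thus become counts of
  sets.\<close>

lemma sum_order_sign_squared:
  fixes g :: "nat set \<Rightarrow> complex"
  shows "(\<Sum>xs\<in>basis_tuples M N. (of_int (order_sign xs))\<^sup>2 * g (set xs)) =
    fact N * (\<Sum>I\<in>subsets_of_card M N. g I)"
proof -
  define D where "D = {xs \<in> basis_tuples M N. distinct xs}"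
  have "(\<Sum>xs\<in>basis_tuples M N. (of_int (order_sign xs))\<^sup>2 * g (set xs)) = (\<Sum>xs\<in>D. g (set xs))"
    unfolding D_def
    by (subst sum.inter_filter)
      (auto simp: order_sign_squared intro!: sum.cong simp flip: of_int_power)
  also have "\<dots> = (\<Sum>I\<in>subsets_of_card M N. \<Sum>xs\<in>{xs \<in> D. set xs = I}. g (set xs))"
    by (intro sum.group[symmetric])
      (auto simp: D_def subsets_of_card_def basis_tuples_def distinct_card
        intro: finite_subset[OF _ finite_basis_tuples[of M N]])
  also have "\<dots> = (\<Sum>I\<in>subsets_of_card M N. fact N * g I)"
  proof (rule sum.cong[OF refl])
    fix I assume I: "I \<in> subsets_of_card M N"
    then have "finite I" "card I = N"
      by (auto simp: subsets_of_card_def intro: finite_subset)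
    moreover have "{xs \<in> D. set xs = I} = permutations_of_set I"
      using I by (auto simp: D_def permutations_of_set_def basis_tuples_def subsets_of_card_def
          dest: distinct_card)
    ultimately have "card {xs \<in> D. set xs = I} = fact N"
      by simp
    then show "(\<Sum>xs\<in>{xs \<in> D. set xs = I}. g (set xs)) = fact N * g I"
      by simp
  qed
  finally show ?thesis by (simp add: sum_distrib_left)
qed

text \<open>Up to a factor, the amplitude at \<open>xs\<close> of the sum over \<open>I \<in> F\<close> of the Slater determinants
  of the basis vectors in \<open>I\<close>, each taken in increasing order.\<close>

definition slater_amplitude :: "nat set set \<Rightarrow> nat list \<Rightarrow> complex" where
  "slater_amplitude F xs = (if set xs \<in> F then of_int (order_sign xs) else 0)"

lemma cnj_slater_amplitude [simp]: "cnj (slater_amplitude F xs) = slater_amplitude F xs"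
  by (simp add: slater_amplitude_def)

lemma slater_amplitude_append_swap:
  "slater_amplitude F (xs @ ys) = (- 1) ^ (length xs * length ys) * slater_amplitude F (ys @ xs)"
  by (simp add: slater_amplitude_def order_sign_append_swap[of xs ys] Un_commute)

definition slater_vec :: "nat \<Rightarrow> nat \<Rightarrow> nat set set \<Rightarrow> complex vec" where
  "slater_vec M N F =
     vec (M ^ N) (\<lambda>i. slater_amplitude F (inv_into (basis_tuples M N) (tensor_index M) i))"

lemma dim_slater_vec [simp]: "dim_vec (slater_vec M N F) = M ^ N"
  by (simp add: slater_vec_def)

lemma slater_vec_index:
  assumes "xs \<in> basis_tuples M N"
  shows "slater_vec M N F $ tensor_index M xs = slater_amplitude F xs"
proof -
  have "tensor_index M xs < M ^ N"
    using assms tensor_index_less[of xs M] by (simp add: basis_tuples_def)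
  then show ?thesis
    using assms inj_on_tensor_index by (simp add: slater_vec_def inv_into_f_f)
qed

lemma smult_slater_vec_antisymmetric: "c \<cdot>\<^sub>v slater_vec M N F \<in> antisymmetric_space M N"
proof -
  have "slater_vec M N F $ tensor_index M (permute_list \<sigma> xs) =
      of_int (sign \<sigma>) * slater_vec M N F $ tensor_index M xs"
    if "\<sigma> permutes {..<N}" "xs \<in> basis_tuples M N" for \<sigma> xs
  proof -
    have \<sigma>: "\<sigma> permutes {..<length xs}" using that by (simp add: basis_tuples_def)
    then have "permute_list \<sigma> xs \<in> basis_tuples M N"
      using that by (simp add: basis_tuples_def)
    then show ?thesis
      using that \<sigma>
      by (simp add: slater_vec_index slater_amplitude_def order_sign_permute_list)
  qed
  moreover have "tensor_index M xs < M ^ N" if "xs \<in> basis_tuples M N" for xs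
    using that tensor_index_less[of xs M] by (simp add: basis_tuples_def)
  moreover have "permute_list \<sigma> xs \<in> basis_tuples M N"
    if "\<sigma> permutes {..<N}" "xs \<in> basis_tuples M N" for \<sigma> xs
    using that by (auto simp: basis_tuples_def)
  ultimately show ?thesis
    by (auto simp: antisymmetric_space_def slater_vec_def)
qed

lemma slater_vec_norm:
  assumes "F \<subseteq> subsets_of_card M N"
  shows "slater_vec M N F \<bullet>c slater_vec M N F = fact N * of_nat (card F)"
proof -
  have "slater_vec M N F \<bullet>c slater_vec M N F =
      (\<Sum>i<M ^ N. slater_vec M N F $ i * cnj (slater_vec M N F $ i))"
    by (simp add: scalar_prod_def slater_vec_def lessThan_atLeast0)
  also have "\<dots> = (\<Sum>xs\<in>basis_tuples M N. (of_int (order_sign xs))\<^sup>2 * (if set xs \<in> F then 1 else 0))"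
    by (auto simp: sum_tensor_index slater_vec_index slater_amplitude_def power2_eq_square
        intro!: sum.cong)
  also have "\<dots> = fact N * (\<Sum>I\<in>subsets_of_card M N. if I \<in> F then 1 else 0)"
    by (rule sum_order_sign_squared)
  also have "(\<Sum>I\<in>subsets_of_card M N. if I \<in> F then 1 else 0 :: complex) = of_nat (card F)"
    using assms by (simp flip: sum.inter_restrict add: Int_absorb1)
  finally show ?thesis .
qed

text \<open>For fixed \<open>zs\<close> the product of amplitudes is the squared sign of
  \<open>ys\<close> times \<open>order_sign zs\<close> and a cross sign. Since the latter is
  constantly \<open>e\<close>, only the number of members of \<open>G\<close> completing
  \<open>set zs\<close> to a member of \<open>F\<close> remains.\<close>

lemma slater_amplitude_contraction:
  assumes G: "G \<subseteq> subsets_of_card M K"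
    and mem: "\<And>I. I \<in> G \<Longrightarrow> I \<inter> set zs = {} \<Longrightarrow> I \<union> set zs \<in> F \<Longrightarrow> set zs \<in> H"
    and count: "set zs \<in> H \<Longrightarrow> card {I \<in> G. I \<inter> set zs = {} \<and> I \<union> set zs \<in> F} = b"
    and cross: "\<And>ys. distinct ys \<Longrightarrow> distinct zs \<Longrightarrow> set ys \<in> G \<Longrightarrow> set zs \<in> H \<Longrightarrow>
      set ys \<inter> set zs = {} \<Longrightarrow> cross_sign ys zs = e"
  shows "(\<Sum>ys\<in>basis_tuples M K. slater_amplitude F (ys @ zs) * slater_amplitude G ys) =
    of_int e * fact K * of_nat b * slater_amplitude H zs"
proof -
  define A where "A = {I \<in> G. I \<inter> set zs = {} \<and> I \<union> set zs \<in> F}"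
  have A: "A \<subseteq> subsets_of_card M K" using G by (auto simp: A_def)
  have eq: "slater_amplitude F (ys @ zs) * slater_amplitude G ys =
      (of_int (order_sign ys))\<^sup>2 * (if set ys \<in> A then of_int (e * order_sign zs) else 0)" for ys
  proof (cases "set ys \<in> A \<and> distinct ys \<and> distinct zs")
    case True
    then have "cross_sign ys zs = e"
      using mem cross by (auto simp: A_def)
    then show ?thesis
      using True by (simp add: A_def slater_amplitude_def order_sign_append power2_eq_square)
  next
    \<comment> \<open>Both sides vanish here: either a membership fails, or \<open>ys\<close>,
      \<open>zs\<close> or their concatenation repeats an entry.\<close>
    case False
    then show ?thesis
      by (auto simp: A_def slater_amplitude_def order_sign_not_distinct)
  qed
  have "(\<Sum>ys\<in>basis_tuples M K. slater_amplitude F (ys @ zs) * slater_amplitude G ys) =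
      fact K * (\<Sum>I\<in>subsets_of_card M K. if I \<in> A then of_int (e * order_sign zs) else 0)"
    unfolding eq by (rule sum_order_sign_squared)
  also have "(\<Sum>I\<in>subsets_of_card M K. if I \<in> A then of_int (e * order_sign zs) else 0) =
      of_nat (card A) * (of_int (e * order_sign zs) :: complex)"
    using A by (simp flip: sum.inter_restrict add: Int_absorb1)
  also have "of_nat (card A) * (of_int (e * order_sign zs) :: complex) =
      of_int e * of_nat b * slater_amplitude H zs"
  proof (cases "set zs \<in> H")
    case True
    then show ?thesis using count by (simp add: A_def slater_amplitude_def)
  next
    case False
    then have "A = {}" using mem by (auto simp: A_def)
    with False show ?thesis by (simp add: slater_amplitude_def)
  qed
  finally show ?thesis by (simp add: mult_ac)
qed

text \<open>Under the membership and counting hypotheses A* maps the superposition for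
  \<open>G\<close> to a multiple of the one for \<open>H\<close>, with count \<open>b\<close>, and A
  maps it back, with count \<open>a\<close>. The superposition for \<open>G\<close> is therefore an
  eigenvector of A A*.\<close>

lemma Lambda_ge_slater:
  assumes "M > 0" "K \<le> N"
    and F: "F \<subseteq> subsets_of_card M N" "F \<noteq> {}"
    and G: "G \<subseteq> subsets_of_card M K" "G \<noteq> {}"
    and H: "H \<subseteq> subsets_of_card M (N - K)"
    and memH: "\<And>I T. I \<in> G \<Longrightarrow> I \<inter> T = {} \<Longrightarrow> I \<union> T \<in> F \<Longrightarrow> T \<in> H"
    and memG: "\<And>I T. T \<in> H \<Longrightarrow> I \<inter> T = {} \<Longrightarrow> I \<union> T \<in> F \<Longrightarrow> I \<in> G"
    and countG: "\<And>T. T \<in> H \<Longrightarrow> card {I \<in> G. I \<inter> T = {} \<and> I \<union> T \<in> F} = b"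
    and countH: "\<And>I. I \<in> G \<Longrightarrow> card {T \<in> H. I \<inter> T = {} \<and> I \<union> T \<in> F} = a"
    and cross: "\<And>ys zs. distinct ys \<Longrightarrow> distinct zs \<Longrightarrow> set ys \<in> G \<Longrightarrow> set zs \<in> H \<Longrightarrow>
      set ys \<inter> set zs = {} \<Longrightarrow> cross_sign ys zs = 1"
  shows "real a * real b / (real (card F) * real (N choose K)) \<le> Lambda M N K"
proof -
  \<comment> \<open>\<open>w\<close> is the squared norm of the unnormalised superposition, so
    \<open>c\<close> normalises it.\<close>
  define w :: real where "w = fact N * real (card F)"
  define c where "c = complex_of_real (1 / sqrt w)"
  define \<Psi> where "\<Psi> = c \<cdot>\<^sub>v slater_vec M N F"
  have "finite F" using F(1) by (rule finite_subset) simp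
  with F(2) have card_F: "card F > 0" by (simp add: card_gt_0_iff)
  then have w: "w > 0" by (simp add: w_def)
  have c: "c * c = complex_of_real (1 / w)"
    using w by (simp add: c_def flip: of_real_mult)
  have \<Psi>_anti: "\<Psi> \<in> antisymmetric_space M N"
    unfolding \<Psi>_def by (rule smult_slater_vec_antisymmetric)
  then have \<Psi>_carrier: "\<Psi> \<in> carrier_vec (M ^ N)"
    by (simp add: antisymmetric_space_def)
  have "\<Psi> \<bullet>c \<Psi> = c * c * (slater_vec M N F \<bullet>c slater_vec M N F)"
    by (simp add: \<Psi>_def scalar_prod_def slater_vec_def sum_distrib_left c_def mult_ac)
  also have "\<dots> = 1"
    using card_F by (simp add: slater_vec_norm[OF F(1)] c w_def)
  finally have \<Psi>_norm: "\<Psi> \<bullet>c \<Psi> = 1" .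
  have \<Psi>_index: "\<Psi> $ (tensor_index M xs * M ^ (N - K) + tensor_index M zs) =
      c * slater_amplitude F (xs @ zs)"
    if "xs \<in> basis_tuples M K" "zs \<in> basis_tuples M (N - K)" for xs zs
  proof -
    have mem: "xs @ zs \<in> basis_tuples M N"
      using that assms(2) by (auto simp: basis_tuples_def)
    then have "tensor_index M (xs @ zs) < M ^ N"
      using tensor_index_less[of "xs @ zs" M] by (simp add: basis_tuples_def)
    then have "\<Psi> $ tensor_index M (xs @ zs) = c * slater_amplitude F (xs @ zs)"
      using mem by (simp add: \<Psi>_def slater_vec_index)
    then show ?thesis
      using that by (simp add: tensor_index_append basis_tuples_def)
  qed
  have inner: "(\<Sum>ys\<in>basis_tuples M K. cnj (c * slater_amplitude F (ys @ zs)) * slater_amplitude G ys) =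
      c * fact K * of_nat b * slater_amplitude H zs" for zs
  proof -
    have "(\<Sum>ys\<in>basis_tuples M K. cnj (c * slater_amplitude F (ys @ zs)) * slater_amplitude G ys) =
        c * (\<Sum>ys\<in>basis_tuples M K. slater_amplitude F (ys @ zs) * slater_amplitude G ys)"
      by (simp add: sum_distrib_left mult_ac c_def)
    also have "(\<Sum>ys\<in>basis_tuples M K. slater_amplitude F (ys @ zs) * slater_amplitude G ys) =
        of_int 1 * fact K * of_nat b * slater_amplitude H zs"
      by (rule slater_amplitude_contraction[OF G(1)]; rule memH countG cross)
    finally show ?thesis by (simp add: mult_ac)
  qed
  have outer: "(\<Sum>zs\<in>basis_tuples M (N - K). slater_amplitude F (xs @ zs) * slater_amplitude H zs) =
      fact (N - K) * of_nat a * slater_amplitude G xs" if "xs \<in> basis_tuples M K" for xs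
  proof -
    \<comment> \<open>The contraction lemma sums over the first block, so the blocks are swapped.
      The sign \<open>s\<close> arises once from this swap and once from the cross sign in the
      swapped order, and it squares to 1.\<close>
    define s :: int where "s = (- 1) ^ (K * (N - K))"
    have s: "of_int s * of_int s = (1 :: complex)"
      by (simp add: s_def flip: of_int_mult power_mult_distrib)
    have len: "length xs = K" using that by (simp add: basis_tuples_def)
    have card_zs: "length zs = N - K" if "distinct zs" "set zs \<in> H" for zs
      using that H distinct_card[of zs] by (auto simp: subsets_of_card_def)
    have "(\<Sum>zs\<in>basis_tuples M (N - K). slater_amplitude F (xs @ zs) * slater_amplitude H zs) =
        of_int s * (\<Sum>zs\<in>basis_tuples M (N - K). slater_amplitude F (zs @ xs) * slater_amplitude H zs)"
      by (auto simp: sum_distrib_left s_def len basis_tuples_def mult.assoc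
          slater_amplitude_append_swap[of F xs] intro!: sum.cong)
    also have "(\<Sum>zs\<in>basis_tuples M (N - K). slater_amplitude F (zs @ xs) * slater_amplitude H zs) =
        of_int s * fact (N - K) * of_nat a * slater_amplitude G xs"
    proof (rule slater_amplitude_contraction[OF H])
      show "set xs \<in> G" if "T \<in> H" "T \<inter> set xs = {}" "T \<union> set xs \<in> F" for T
        using that by (intro memG[of T]) (auto simp: Int_commute Un_commute)
      show "card {T \<in> H. T \<inter> set xs = {} \<and> T \<union> set xs \<in> F} = a" if "set xs \<in> G"
        using countH[OF that] by (simp add: Int_commute Un_commute)
      show "cross_sign zs xs = s"
        if "distinct zs" "distinct xs" "set zs \<in> H" "set xs \<in> G" "set zs \<inter> set xs = {}" for zs
        using that cross[of xs zs] card_zs[of zs] len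
        by (simp add: cross_sign_swap[of zs xs] s_def Int_commute mult.commute)
    qed
    also have "of_int s * (of_int s * fact (N - K) * of_nat a * slater_amplitude G xs) =
        fact (N - K) * of_nat a * slater_amplitude G xs"
      using s by (simp flip: mult.assoc)
    finally show ?thesis .
  qed
  define v where "v i = slater_vec M K G $ i" for i
  define x where "x = real a * real b / (real (card F) * real (N choose K))"
  have x: "c * c * (fact K * of_nat b * (fact (N - K) * of_nat a)) = complex_of_real x"
  proof -
    \<comment> \<open>The two contractions give \<open>fact K\<close> and
      \<open>fact (N - K)\<close>, the normalisation gives 1 over \<open>fact N\<close>, and
      together they form the inverse binomial coefficient.\<close>
    have "1 / w * (fact K * real b * (fact (N - K) * real a)) = x"
      using w assms(2) by (simp add: x_def w_def binomial_fact field_simps)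
    from arg_cong[OF this, of complex_of_real] show ?thesis
      by (simp add: c)
  qed
  have "eigenvalue (reduced_density_matrix M N K \<Psi>) (complex_of_real x)"
    unfolding reduced_density_matrix_eq_gram_mat[OF \<Psi>_carrier assms(2)] eigenvalue_gram_mat_iff
  proof (intro exI[of _ v] conjI allI impI)
    \<comment> \<open>At any listing of a member of \<open>G\<close> without repetitions the
      amplitude is a nonzero sign, so the eigenvector is not zero.\<close>
    obtain I where I: "I \<in> G" using G(2) by blast
    then have "I \<subseteq> {..<M}" "card I = K" using G(1) by (auto simp: subsets_of_card_def)
    moreover obtain xs where xs: "set xs = I" "distinct xs"
      using finite_distinct_list[of I] \<open>I \<subseteq> {..<M}\<close> finite_subset by blast
    ultimately have mem: "xs \<in> basis_tuples M K"
      using distinct_card[of xs] by (simp add: basis_tuples_def)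
    then have "v (tensor_index M xs) \<noteq> 0"
      using xs I by (simp add: v_def slater_vec_index slater_amplitude_def order_sign_eq_0_iff)
    then show "\<exists>i<M ^ K. v i \<noteq> 0"
      using mem tensor_index_less[of xs M] by (auto simp: basis_tuples_def)
  next
    fix i assume "i < M ^ K"
    then obtain xs where xs: "xs \<in> basis_tuples M K" "i = tensor_index M xs"
      by (rule tensor_index_surj)
    have "(\<Sum>l<M ^ (N - K). \<Psi> $ (i * M ^ (N - K) + l) *
          (\<Sum>j<M ^ K. cnj (\<Psi> $ (j * M ^ (N - K) + l)) * v j)) =
        (\<Sum>zs\<in>basis_tuples M (N - K). c * slater_amplitude F (xs @ zs) *
          (\<Sum>ys\<in>basis_tuples M K. cnj (c * slater_amplitude F (ys @ zs)) * slater_amplitude G ys))"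
      unfolding sum_tensor_index xs(2)
      by (intro sum.cong arg_cong2[where f = "(*)"] refl)
        (simp_all add: \<Psi>_index xs(1) v_def slater_vec_index)
    also have "\<dots> = c * c * fact K * of_nat b *
        (\<Sum>zs\<in>basis_tuples M (N - K). slater_amplitude F (xs @ zs) * slater_amplitude H zs)"
      unfolding inner by (simp add: sum_distrib_left mult_ac)
    also have "\<dots> = complex_of_real x * v i"
      unfolding outer[OF xs(1)] x[symmetric]
      by (simp add: v_def xs slater_vec_index mult_ac)
    finally show "(\<Sum>l<M ^ (N - K). \<Psi> $ (i * M ^ (N - K) + l) *
        (\<Sum>j<M ^ K. cnj (\<Psi> $ (j * M ^ (N - K) + l)) * v j)) = complex_of_real x * v i" .
  qed
  from Lambda_ge[OF assms(1,2) \<Psi>_anti \<Psi>_norm this] show ?thesis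
    by (simp add: x_def)
qed

section \<open>Paired states\<close>

text \<open>Orbitals \<open>2 * i\<close> and \<open>2 * i + 1\<close> form the pair labelled
  \<open>i\<close>. As a preimage under halving, \<open>pairs\<close> commutes with the set
  operations.\<close>

definition pairs :: "nat set \<Rightarrow> nat set" where
  "pairs S = {x. x div 2 \<in> S}"

lemma pairs_UN: "pairs S = (\<Union>i\<in>S. {2 * i, 2 * i + 1})"
  by (auto simp: pairs_def)

lemma finite_pairs: "finite S \<Longrightarrow> finite (pairs S)"
  by (simp add: pairs_UN)

lemma pair_disjoint: "i \<noteq> j \<Longrightarrow> {2 * i, 2 * i + 1} \<inter> {2 * j, 2 * j + 1 :: nat} = {}"
  by auto

lemma prod_pairs:
  assumes "finite S"
  shows "(\<Prod>x\<in>pairs S. f x) = (\<Prod>i\<in>S. f (2 * i) * f (2 * i + 1))"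
  unfolding pairs_UN using assms pair_disjoint by (subst prod.UNION_disjoint) simp_all

lemma card_pairs: "finite S \<Longrightarrow> card (pairs S) = 2 * card S"
  unfolding pairs_UN using pair_disjoint by (subst card_UN_disjoint) simp_all

lemma pairs_mono_iff: "pairs S \<subseteq> pairs T \<longleftrightarrow> S \<subseteq> T"
  by (auto simp: pairs_def subset_iff) (metis nonzero_mult_div_cancel_left zero_neq_numeral)

lemma pairs_disjoint_iff: "pairs S \<inter> pairs T = {} \<longleftrightarrow> S \<inter> T = {}"
  by (auto simp: pairs_def set_eq_iff) (metis nonzero_mult_div_cancel_left zero_neq_numeral)

lemma pairs_Un: "pairs (S \<union> T) = pairs S \<union> pairs T"
  and pairs_Diff: "pairs (S - T) = pairs S - pairs T"
  by (auto simp: pairs_def)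

lemma pairs_less: "S \<subseteq> {..<p} \<Longrightarrow> pairs S \<subseteq> {..<2 * p}"
  by (auto simp: pairs_def)

text \<open>The occupation sets of a paired state: \<open>k\<close> of the \<open>p\<close> pairs
  are filled, and \<open>X\<close> holds the fixed orbitals, later always placed above all
  pairs.\<close>

definition pair_sets :: "nat \<Rightarrow> nat \<Rightarrow> nat set \<Rightarrow> nat set set" where
  "pair_sets p k X = (\<lambda>S. pairs S \<union> X) ` {S. S \<subseteq> {..<p} \<and> card S = k}"

lemma pair_sets_subset:
  assumes "X \<subseteq> {2 * p..<M}" "2 * p \<le> M" "N = 2 * k + card X"
  shows "pair_sets p k X \<subseteq> subsets_of_card M N"
proof
  fix I assume "I \<in> pair_sets p k X"
  then obtain S where S: "I = pairs S \<union> X" "S \<subseteq> {..<p}" "card S = k"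
    by (auto simp: pair_sets_def)
  have fin: "finite S" "finite X"
    using S(2) assms(1) finite_subset by blast+
  have "pairs S \<inter> X = {}"
    using pairs_less[OF S(2)] assms(1) by fastforce
  then have "card I = N"
    using S fin assms(3) by (simp add: card_Un_disjoint finite_pairs card_pairs)
  moreover have "I \<subseteq> {..<M}"
    using S(1) pairs_less[OF S(2)] assms(1,2) by fastforce
  ultimately show "I \<in> subsets_of_card M N"
    by (simp add: subsets_of_card_def)
qed

lemma inj_on_pairs_Un:
  assumes "X \<subseteq> {2 * p..}"
  shows "inj_on (\<lambda>S. pairs S \<union> X) (Pow {..<p})"
proof (rule inj_onI)
  fix S T assume ST: "S \<in> Pow {..<p}" "T \<in> Pow {..<p}" and eq: "pairs S \<union> X = pairs T \<union> X"
  have "pairs S \<inter> X = {}" "pairs T \<inter> X = {}"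
    using pairs_less[of S p] pairs_less[of T p] ST assms by fastforce+
  with eq have "pairs S = pairs T" by blast
  then show "S = T" by (metis pairs_mono_iff order.refl subset_antisym)
qed

lemma card_pair_sets:
  assumes "X \<subseteq> {2 * p..}"
  shows "card (pair_sets p k X) = p choose k"
proof -
  have "card (pair_sets p k X) = card {S. S \<subseteq> {..<p} \<and> card S = k}"
    unfolding pair_sets_def
    by (intro card_image inj_on_subset[OF inj_on_pairs_Un[OF assms]]) auto
  then show ?thesis by (simp add: n_subsets)
qed

text \<open>Pairs live below \<open>2 * p\<close> and fixed orbitals above, so the two kinds can be
  compared separately: the labels of \<open>I\<close> are among those of the union, and
  \<open>T\<close> consists of the leftover pairs and \<open>Y\<close>.\<close>

lemma pair_sets_complement:
  assumes "X \<subseteq> {2 * p..}" "Y \<subseteq> {2 * p..}" "X \<inter> Y = {}"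
    and "I \<in> pair_sets p k X" "I \<inter> T = {}" "I \<union> T \<in> pair_sets p (k + l) (X \<union> Y)"
  shows "T \<in> pair_sets p l Y"
proof -
  obtain S where S: "I = pairs S \<union> X" "S \<subseteq> {..<p}" "card S = k"
    using assms(4) by (auto simp: pair_sets_def)
  obtain R where R: "I \<union> T = pairs R \<union> (X \<union> Y)" "R \<subseteq> {..<p}" "card R = k + l"
    using assms(6) by (auto simp: pair_sets_def)
  have disj: "pairs S \<inter> (X \<union> Y) = {}" "pairs R \<inter> (X \<union> Y) = {}"
    using pairs_less[OF S(2)] pairs_less[OF R(2)] assms(1,2) by fastforce+
  have "pairs S \<subseteq> pairs R"
    using S(1) R(1) disj by blast
  then have "S \<subseteq> R" by (simp add: pairs_mono_iff)
  then have "card (R - S) = l"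
    using S R finite_subset[OF S(2)] by (simp add: card_Diff_subset)
  moreover have "T = pairs (R - S) \<union> Y"
    unfolding pairs_Diff using S(1) R(1) disj assms(3,5) by blast
  ultimately show ?thesis
    using R(2) by (auto simp: pair_sets_def)
qed

text \<open>The admissible \<open>I\<close> are those whose pairs avoid the \<open>l\<close> pairs
  of \<open>T\<close>, so \<open>k\<close> labels are chosen freely from the other
  \<open>p - l\<close>.\<close>

lemma card_pair_sets_complement:
  assumes "X \<subseteq> {2 * p..}" "Y \<subseteq> {2 * p..}" "X \<inter> Y = {}" and "T \<in> pair_sets p l Y"
  shows "card {I \<in> pair_sets p k X. I \<inter> T = {} \<and> I \<union> T \<in> pair_sets p (k + l) (X \<union> Y)} =
    (p - l) choose k"
proof -
  obtain U where U: "T = pairs U \<union> Y" "U \<subseteq> {..<p}" "card U = l"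
    using assms(4) by (auto simp: pair_sets_def)
  have finU: "finite U" using U(2) finite_subset by blast
  have "{I \<in> pair_sets p k X. I \<inter> T = {} \<and> I \<union> T \<in> pair_sets p (k + l) (X \<union> Y)} =
      (\<lambda>S. pairs S \<union> X) ` {S. S \<subseteq> {..<p} - U \<and> card S = k}" (is "?L = ?R")
  proof (intro equalityI subsetI)
    fix I assume I: "I \<in> ?L"
    then obtain S where S: "I = pairs S \<union> X" "S \<subseteq> {..<p}" "card S = k"
      by (auto simp: pair_sets_def)
    have "pairs S \<inter> pairs U = {}" using I S(1) U(1) by blast
    then show "I \<in> ?R" using S by (auto simp: pairs_disjoint_iff)
  next
    fix I assume "I \<in> ?R"
    then obtain S where S: "I = pairs S \<union> X" "S \<subseteq> {..<p} - U" "card S = k"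
      by blast
    have sub: "S \<subseteq> {..<p}" using S(2) by blast
    have finS: "finite S" using sub finite_subset by blast
    have disj: "pairs S \<inter> Y = {}" "pairs U \<inter> X = {}"
      using pairs_less[OF sub] pairs_less[OF U(2)] assms(1,2) by fastforce+
    have "S \<inter> U = {}" using S(2) by blast
    then have card: "card (S \<union> U) = k + l" and "pairs S \<inter> pairs U = {}"
      using S(3) U(3) finS finU by (simp_all add: card_Un_disjoint pairs_disjoint_iff)
    then have "I \<inter> T = {}"
      using S(1) U(1) disj assms(3) by blast
    moreover have "I \<union> T = pairs (S \<union> U) \<union> (X \<union> Y)"
      using S(1) U(1) by (auto simp: pairs_Un)
    then have "I \<union> T \<in> pair_sets p (k + l) (X \<union> Y)"
      using card sub U(2) by (auto simp: pair_sets_def)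
    moreover have "I \<in> pair_sets p k X"
      using S sub by (auto simp: pair_sets_def)
    ultimately show "I \<in> ?L" by blast
  qed
  moreover have "card ?R = card {S. S \<subseteq> {..<p} - U \<and> card S = k}"
    by (intro card_image inj_on_subset[OF inj_on_pairs_Un[OF assms(1)]]) auto
  moreover have "card ({..<p} - U) = p - l"
    using U finU by (simp add: card_Diff_subset)
  ultimately show ?thesis by (simp add: n_subsets)
qed

text \<open>The two members of a pair lie on the same side of any other orbital, so a pair
  can be moved past it without a sign.\<close>

lemma cross_sign_pairs:
  assumes "distinct ys" "set ys = pairs U \<union> Y" "finite U"
    and "set xs \<inter> pairs U = {}" "\<And>x y. x \<in> set xs \<Longrightarrow> y \<in> Y \<Longrightarrow> x < y"
  shows "cross_sign xs ys = 1"
proof -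
  have "(\<Prod>y\<leftarrow>ys. sgn (int y - int x)) = 1" if x: "x \<in> set xs" for x
  proof -
    have fin: "finite (pairs U)" "finite Y"
      using assms(2,3) finite_pairs finite_set[of ys] by auto
    have one: "sgn (int y - int x) = 1" if "y \<in> Y" for y
      using assms(5)[OF x that] by simp
    have pair: "sgn (int (2 * i) - int x) * sgn (int (2 * i + 1) - int x) = 1" if "i \<in> U" for i
    proof -
      have "x \<noteq> 2 * i" "x \<noteq> 2 * i + 1"
        using assms(4) x that by (auto simp: pairs_UN)
      then have "x < 2 * i \<or> x > 2 * i + 1" by linarith
      then show ?thesis by (auto simp: sgn_if)
    qed
    have "(\<Prod>y\<leftarrow>ys. sgn (int y - int x)) = (\<Prod>y\<in>pairs U \<union> Y. sgn (int y - int x))"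
      unfolding assms(2)[symmetric] by (rule prod.distinct_set_conv_list[OF assms(1), symmetric])
    also have "\<dots> = (\<Prod>y\<in>pairs U. sgn (int y - int x))"
      using fin one by (intro prod.mono_neutral_right) auto
    also have "\<dots> = 1"
      unfolding prod_pairs[OF assms(3)] by (intro prod.neutral ballI pair)
    finally show ?thesis .
  qed
  then have "cross_sign xs ys = (\<Prod>x\<leftarrow>xs. 1)"
    unfolding cross_sign_def by (intro arg_cong[where f = prod_list] map_cong) auto
  then show ?thesis by (simp add: map_replicate_const)
qed

text \<open>The state is the wedge product of \<open>s + t\<close> fixed orbitals with the equal superposition of all
  choices of \<open>q\<close> among \<open>p\<close> pairs; the eigenvector combines \<open>s\<close> of the fixed orbitals with the
  superposition for \<open>k\<close> pairs.\<close>

lemma Lambda_ge_pairs: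
  assumes "M > 0" "k \<le> q" "q \<le> p" "2 * p + s + t \<le> M"
    and N: "N = 2 * q + s + t" and K: "K = 2 * k + s"
  shows "real (q choose k) / real (N choose K) * (real ((p - q + k) choose k) / real (p choose k))
    \<le> Lambda M N K"
proof -
  define l where "l = q - k"
  \<comment> \<open>\<open>X\<close> belongs to the first block and \<open>Y\<close> to the second.
    Placing \<open>Y\<close> above \<open>X\<close> and all pairs makes every comparison with
    \<open>Y\<close> positive, so the cross sign is 1.\<close>
  define X Y where "X = {2 * p..<2 * p + s}" and "Y = {2 * p + s..<2 * p + s + t}"
  have q: "q = k + l" using assms(2) by (simp add: l_def)
  have XY: "X \<subseteq> {2 * p..}" "Y \<subseteq> {2 * p..}" "X \<inter> Y = {}" "Y \<inter> X = {}"
    "X \<subseteq> {2 * p..<M}" "Y \<subseteq> {2 * p..<M}" "X \<union> Y \<subseteq> {2 * p..<M}" "X \<union> Y \<subseteq> {2 * p..}"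
    using assms(4) by (auto simp: X_def Y_def)
  have cards: "card X = s" "card Y = t" "card (X \<union> Y) = s + t"
    by (simp_all add: X_def Y_def card_Un_disjoint)
  \<comment> \<open>The numerator counts the ways to complete \<open>k\<close> pairs by
    \<open>l\<close> others and \<open>l\<close> pairs by \<open>k\<close> others.\<close>
  have "real ((p - k) choose l) * real ((p - l) choose k) /
      (real (card (pair_sets p q (X \<union> Y))) * real (N choose K)) \<le> Lambda M N K"
  proof (rule Lambda_ge_slater)
    show "pair_sets p q (X \<union> Y) \<subseteq> subsets_of_card M N"
      using XY assms cards by (intro pair_sets_subset) auto
    show "pair_sets p k X \<subseteq> subsets_of_card M K"
      using XY assms cards by (intro pair_sets_subset) auto
    show "pair_sets p l Y \<subseteq> subsets_of_card M (N - K)"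
      using XY assms cards by (intro pair_sets_subset) (auto simp: l_def)
    have "card (pair_sets p q (X \<union> Y)) > 0" "card (pair_sets p k X) > 0"
      using assms XY by (simp_all add: card_pair_sets)
    then show "pair_sets p q (X \<union> Y) \<noteq> {}" "pair_sets p k X \<noteq> {}"
      by auto
    show "T \<in> pair_sets p l Y"
      if "I \<in> pair_sets p k X" "I \<inter> T = {}" "I \<union> T \<in> pair_sets p q (X \<union> Y)" for I T
      using that XY q by (intro pair_sets_complement[of X p Y I k T l]) auto
    show "I \<in> pair_sets p k X"
      if "T \<in> pair_sets p l Y" "I \<inter> T = {}" "I \<union> T \<in> pair_sets p q (X \<union> Y)" for I T
      using that XY q
      by (intro pair_sets_complement[of Y p X T l I k]) (auto simp: ac_simps)
    show "card {I \<in> pair_sets p k X. I \<inter> T = {} \<and> I \<union> T \<in> pair_sets p q (X \<union> Y)} =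
        (p - l) choose k" if "T \<in> pair_sets p l Y" for T
      using card_pair_sets_complement[of X p Y T l k] that XY q by simp
    show "card {T \<in> pair_sets p l Y. I \<inter> T = {} \<and> I \<union> T \<in> pair_sets p q (X \<union> Y)} =
        (p - k) choose l" if "I \<in> pair_sets p k X" for I
      using card_pair_sets_complement[of Y p X I k l] that XY q by (simp add: ac_simps)
    show "cross_sign ys zs = 1"
      if d: "distinct zs" and ys: "set ys \<in> pair_sets p k X" and zs: "set zs \<in> pair_sets p l Y"
        and disj: "set ys \<inter> set zs = {}" for ys zs
    proof -
      obtain U where U: "set zs = pairs U \<union> Y" "U \<subseteq> {..<p}"
        using zs by (auto simp: pair_sets_def)
      obtain S where S: "set ys = pairs S \<union> X" "S \<subseteq> {..<p}"
        using ys by (auto simp: pair_sets_def)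
      have "set ys \<subseteq> {..<2 * p + s}"
        using pairs_less[OF S(2)] S(1) by (auto simp: X_def)
      then show ?thesis
        using d U disj finite_subset[OF U(2)]
        by (intro cross_sign_pairs[of zs U Y]) (auto simp: Y_def)
    qed
  qed (use assms in auto)
  moreover have "real ((p - k) choose l) * real ((p - l) choose k) /
      (real (card (pair_sets p q (X \<union> Y))) * real (N choose K)) =
    real (q choose k) / real (N choose K) * (real ((p - q + k) choose k) / real (p choose k))"
  proof -
    \<comment> \<open>Choosing \<open>q\<close> pairs and marking \<open>k\<close> of them is
      counted in two ways, which trades the denominator \<open>p choose q\<close> for
      \<open>p choose k\<close>.\<close>
    have "(p choose q) * (q choose k) = (p choose k) * ((p - k) choose l)"
      unfolding l_def using assms(2,3) by (intro choose_mult)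
    then have e: "real (p choose q) * real (q choose k) = real (p choose k) * real ((p - k) choose l)"
      by (metis of_nat_mult)
    have pos: "real (p choose q) > 0" "real (p choose k) > 0"
      using assms(2,3) by simp_all
    have ratio: "real ((p - k) choose l) / real (p choose q) = real (q choose k) / real (p choose k)"
      using e pos by (simp add: field_simps)
    have pl: "p - l = p - q + k"
      using assms(2,3) by (simp add: l_def)
    have "real ((p - k) choose l) * real ((p - l) choose k) /
        (real (card (pair_sets p q (X \<union> Y))) * real (N choose K)) =
      real ((p - k) choose l) / real (p choose q) * (real ((p - q + k) choose k) / real (N choose K))"
      unfolding card_pair_sets[OF XY(8)] pl by simp
    then show ?thesis
      unfolding ratio by (simp add: mult_ac)
  qed
  ultimately show ?thesis by simp
qed

section \<open>The bounds by parity of particle numbers and dimension\<close>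

theorem corollary3p6:
  fixes M N K :: nat
  assumes "1 \<le> K" and "K \<le> N - 1" and "N \<le> M"
  shows
    "(\<forall>m n k. (M = 2 * m \<or> M = 2 * m + 1) \<and> N = 2 * n \<and> K = 2 * k \<longrightarrow>
        Lambda M N K \<ge> real (n choose k) / real (N choose K)
          * (real ((m - n + k) choose k) / real (m choose k))) \<and>
     (\<forall>m n k. (M = 2 * m \<or> M = 2 * m + 1) \<and> N = 2 * n \<and> K = 2 * k + 1 \<longrightarrow>
        Lambda M N K \<ge> real ((n - 1) choose k) / real (N choose K)
          * (real ((m - n + k) choose k) / real ((m - 1) choose k))) \<and>
     (\<forall>m n k. M = 2 * m \<and> N = 2 * n + 1 \<and> K = 2 * k \<longrightarrow>
        Lambda M N K \<ge> real (n choose k) / real (N choose K)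
          * (real ((m - 1 - n + k) choose k) / real ((m - 1) choose k))) \<and>
     (\<forall>m n k. M = 2 * m + 1 \<and> N = 2 * n + 1 \<and> K = 2 * k \<longrightarrow>
        Lambda M N K \<ge> real (n choose k) / real (N choose K)
          * (real ((m - n + k) choose k) / real (m choose k))) \<and>
     Lambda M N K = Lambda M N (N - K) \<and>
     (\<forall>m n k. M = 2 * m \<and> N = 2 * n + 1 \<and> odd K \<and> N - K = 2 * k \<longrightarrow>
        Lambda M N K \<ge> real (n choose k) / real (N choose (N - K))
          * (real ((m - 1 - n + k) choose k) / real ((m - 1) choose k))) \<and>
     (\<forall>m n k. M = 2 * m + 1 \<and> N = 2 * n + 1 \<and> odd K \<and> N - K = 2 * k \<longrightarrow>
        Lambda M N K \<ge> real (n choose k) / real (N choose (N - K))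
          * (real ((m - n + k) choose k) / real (m choose k)))"
proof -
  have M: "M > 0" and KN: "K \<le> N" "K < N"
    using assms by auto
  \<comment> \<open>All particles are paired and there are no fixed orbitals; for odd
    \<open>M\<close> one orbital stays empty.\<close>
  have even_even: "Lambda M N K \<ge> real (n choose k) / real (N choose K)
      * (real ((m - n + k) choose k) / real (m choose k))"
    if "M = 2 * m \<or> M = 2 * m + 1" "N = 2 * n" "K = 2 * k" for m n k
    using that assms M by (intro Lambda_ge_pairs[of M k n m 0 0 N K]) auto
  \<comment> \<open>With \<open>K\<close> and \<open>N - K\<close> both odd, each block receives one
    fixed orbital. This costs two orbitals and two particles, leaving \<open>m - 1\<close> pairs of
    which \<open>n - 1\<close> are filled.\<close>
  have even_odd: "Lambda M N K \<ge> real ((n - 1) choose k) / real (N choose K)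
      * (real ((m - n + k) choose k) / real ((m - 1) choose k))"
    if "M = 2 * m \<or> M = 2 * m + 1" "N = 2 * n" "K = 2 * k + 1" for m n k
  proof -
    \<comment> \<open>With truncated subtraction this relies on \<open>n\<close> being positive,
      which holds because \<open>N\<close> exceeds \<open>K\<close>.\<close>
    have "m - 1 - (n - 1) = m - n" using that assms by auto
    moreover have "real ((n - 1) choose k) / real (N choose K)
        * (real ((m - 1 - (n - 1) + k) choose k) / real ((m - 1) choose k)) \<le> Lambda M N K"
      using that assms M by (intro Lambda_ge_pairs[of M k "n - 1" "m - 1" 1 1 N K]) auto
    ultimately show ?thesis by simp
  qed
  \<comment> \<open>The unpaired particle occupies a fixed orbital of the second block. For even
    \<open>M\<close> this breaks up a pair, so \<open>m - 1\<close> pairs remain. The bound is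
    stated for a general \<open>K'\<close> so that it also applies to \<open>N - K\<close>.\<close>
  have odd_even: "Lambda M N K' \<ge> real (n choose k) / real (N choose K')
      * (real ((m - 1 - n + k) choose k) / real ((m - 1) choose k))"
    if "M = 2 * m" "N = 2 * n + 1" "K' = 2 * k" "K' \<le> N" for m n k K'
    using that assms M by (intro Lambda_ge_pairs[of M k n "m - 1" 0 1 N K']) auto
  \<comment> \<open>For odd \<open>M\<close> the fixed orbital is the one left over by the pairing,
    so all \<open>m\<close> pairs stay available.\<close>
  have odd_odd: "Lambda M N K' \<ge> real (n choose k) / real (N choose K')
      * (real ((m - n + k) choose k) / real (m choose k))"
    if "M = 2 * m + 1" "N = 2 * n + 1" "K' = 2 * k" "K' \<le> N" for m n k K'
    using that assms M by (intro Lambda_ge_pairs[of M k n m 0 1 N K']) auto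
  have dual: "Lambda M N K = Lambda M N (N - K)"
    using M KN(1) by (rule Lambda_complement)
  \<comment> \<open>If \<open>N\<close> and \<open>K\<close> are odd then \<open>N - K\<close> is
    even, so both bounds apply there and are carried back to \<open>K\<close> by duality.\<close>
  note odd_even' = odd_even[of _ _ "N - K", folded dual]
    and odd_odd' = odd_odd[of _ _ "N - K", folded dual]
  show ?thesis
    by (intro conjI allI impI; (elim conjE)?;
      (rule dual | (rule even_even; assumption) | (rule even_odd; assumption)
        | (rule odd_even odd_odd; (assumption | rule KN))
        | (rule odd_even' odd_odd'; (assumption | rule diff_le_self))))
qed

end
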